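(* There is a constant $C>1$ such that for all sufficiently large integers $h$, there is a symmetric $2h\times 2h$ matrix $A\in\{0,1\}^{2h\times 2h}$ with $\mathrm{him}(A)\le 10\log_2 h$ and $\mathrm{mimsup}(A)\ge\sqrt h$.
   Context: For a $0/1$ matrix $M$, a submatrix after permutation is obtained by selecting a sequence of distinct row indices and a sequence of distinct column indices (in any order). $\mathrm{mim}(M)$ is the largest $r$ such that $M$ has the $r\times r$ identity matrix as a submatrix after permutation. $\mathrm{him}(M)$ is the largest $r$ such that $M$ has an $r\times r$ triangular matrix with ones on the diagonal as a submatrix after permutation (triangular: all entries below, or all entries above, the diagonal are $0$). $\mathrm{mimsup}(M)=\limsup_{k\to\infty}\mathrm{mim}(M^{\otimes k})^{1/k}$, where $M^{\otimes k}$ is the $k$-fold Kronecker power. *)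

theory Defs
  imports "HOL-Library.Extended_Real" "Jordan_Normal_Form.Matrix"
begin

definition zero_one_mat :: "int mat \<Rightarrow> bool" where
  "zero_one_mat M \<longleftrightarrow> elements_mat M \<subseteq> {0, 1}"

definition symmetric_mat :: "'a mat \<Rightarrow> bool" where
  "symmetric_mat M \<longleftrightarrow> transpose_mat M = M"

definition kronecker_prod :: "'a::times mat \<Rightarrow> 'a mat \<Rightarrow> 'a mat" where
  "kronecker_prod A B =
     mat (dim_row A * dim_row B) (dim_col A * dim_col B)
       (\<lambda>(i, j). A $$ (i div dim_row B, j div dim_col B) * B $$ (i mod dim_row B, j mod dim_col B))"

primrec kronecker_power :: "'a::semiring_1 mat \<Rightarrow> nat \<Rightarrow> 'a mat" where
  "kronecker_power M 0 = 1\<^sub>m 1"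
| "kronecker_power M (Suc k) = kronecker_prod M (kronecker_power M k)"

(* The sequences of selected row and column indices are \<rho> 0, \<rho> 1, ... and \<sigma> 0, \<sigma> 1, ...;
   they are distinct but in arbitrary order, and the two selections are independent. *)
definition submatrix_up_to_perm :: "'a mat \<Rightarrow> 'a mat \<Rightarrow> bool" where
  "submatrix_up_to_perm N M \<longleftrightarrow>
     (\<exists>\<rho> \<sigma>. inj_on \<rho> {..<dim_row N} \<and> \<rho> ` {..<dim_row N} \<subseteq> {..<dim_row M} \<and>
            inj_on \<sigma> {..<dim_col N} \<and> \<sigma> ` {..<dim_col N} \<subseteq> {..<dim_col M} \<and>
            N = mat (dim_row N) (dim_col N) (\<lambda>(i, j). M $$ (\<rho> i, \<sigma> j)))"

definition triangular_mat :: "'a::zero mat \<Rightarrow> bool" where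
  "triangular_mat T \<longleftrightarrow> upper_triangular T \<or> upper_triangular (transpose_mat T)"

definition ones_on_diagonal :: "'a::one mat \<Rightarrow> bool" where
  "ones_on_diagonal T \<longleftrightarrow> (\<forall>i < dim_row T. T $$ (i, i) = 1)"

(* In both maxima r = 0 is always admissible, and r is at most dim_row M. *)

definition mim :: "int mat \<Rightarrow> nat" where
  "mim M = Max {r. submatrix_up_to_perm (1\<^sub>m r) M}"

definition him :: "int mat \<Rightarrow> nat" where
  "him M = Max {r. \<exists>T \<in> carrier_mat r r.
              triangular_mat T \<and> ones_on_diagonal T \<and> submatrix_up_to_perm T M}"

lemma submatrix_up_to_perm_dim_row_le:
  assumes "submatrix_up_to_perm N M"
  shows "dim_row N \<le> dim_row M"
  using assms card_inj_on_le[of _ "{..<dim_row N}" "{..<dim_row M}"]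
  unfolding submatrix_up_to_perm_def by auto

lemma submatrix_up_to_perm_empty: "submatrix_up_to_perm (1\<^sub>m 0) M"
proof -
  have "1\<^sub>m 0 = mat 0 0 (\<lambda>(i, j). M $$ (i, j))"
    by (rule eq_matI) auto
  then show ?thesis
    unfolding submatrix_up_to_perm_def by (intro exI[of _ "\<lambda>i. i"]) auto
qed

lemma mim_admissible:
  "finite {r. submatrix_up_to_perm (1\<^sub>m r) M}" "{r. submatrix_up_to_perm (1\<^sub>m r) M} \<noteq> {}"
proof -
  show "finite {r. submatrix_up_to_perm (1\<^sub>m r) M}"
    by (rule finite_subset[of _ "{..dim_row M}"])
      (auto dest: submatrix_up_to_perm_dim_row_le)
  show "{r. submatrix_up_to_perm (1\<^sub>m r) M} \<noteq> {}"
    using submatrix_up_to_perm_empty by blast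
qed

lemma him_admissible:
  fixes M :: "int mat"
  defines "S \<equiv> {r. \<exists>T \<in> carrier_mat r r.
             triangular_mat T \<and> ones_on_diagonal T \<and> submatrix_up_to_perm T M}"
  shows "finite S" "S \<noteq> {}"
proof -
  show "finite S" unfolding S_def
    by (rule finite_subset[of _ "{..dim_row M}"])
      (auto dest: submatrix_up_to_perm_dim_row_le)
  have "0 \<in> S" unfolding S_def triangular_mat_def ones_on_diagonal_def
    using submatrix_up_to_perm_empty[of M] by (auto intro!: bexI[of _ "1\<^sub>m 0"])
  then show "S \<noteq> {}" by blast
qed

(* The limes superior is taken in the extended reals, where it always exists. It is in fact
   finite, since mim (kronecker_power M k) is at most dim_row M ^ k. The term k = 0 is irrelevant. *)
definition mimsup :: "int mat \<Rightarrow> ereal" where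
  "mimsup M = limsup (\<lambda>k. ereal (root k (real (mim (kronecker_power M k)))))"

end

theory Submission
  imports Defs
begin

text \<open>
  Let \<open>B\<close> be the \<open>h \<times> h\<close> adjacency matrix of a tournament, with ones put on the diagonal.
  Then \<open>B\<close> and its transpose have only the diagonal in common, so for
  \<open>A = ((0, B), (B\<^sup>T, 0))\<close> the product \<open>A \<otimes> A\<close> contains the Hadamard product of \<open>B\<close> and
  \<open>B\<^sup>T\<close>, that is, the \<open>h \<times> h\<close> identity matrix. Hence \<open>mim (A\<^sup>\<otimes>\<^sup>2\<^sup>k) \<ge> h\<^sup>k\<close>.
  Conversely, a triangular submatrix of \<open>A\<close> with ones on the diagonal splits into one of \<open>B\<close> and
  one of \<open>B\<^sup>T\<close>. A triangular \<open>r \<times> r\<close> submatrix prescribes \<open>r (r - 1) / 2\<close> entries of \<open>B\<close>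
  which are independent for a random tournament, so the union bound over \<open>h\<^sup>2\<^sup>r\<close> positions
  excludes all of them once \<open>r\<close> exceeds \<open>5 log\<^sub>2 h\<close>.
\<close>

section \<open>Tournaments without large triangular submatrices\<close>

text \<open>Only the zeros strictly below the diagonal count, as they alone drive the union bound.
  Patterns with zeros above the diagonal reduce to these by reversing the index order.\<close>

definition triangle_free :: "nat \<Rightarrow> (nat \<Rightarrow> nat \<Rightarrow> bool) \<Rightarrow> nat \<Rightarrow> bool" where
  "triangle_free h B r \<longleftrightarrow>
     (\<forall>\<rho> \<sigma>. inj_on \<rho> {..<r} \<longrightarrow> \<rho> ` {..<r} \<subseteq> {..<h} \<longrightarrow> inj_on \<sigma> {..<r} \<longrightarrow> \<sigma> ` {..<r} \<subseteq> {..<h} \<longrightarrow>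
        (\<exists>i<r. \<exists>j<i. B (\<rho> i) (\<sigma> j)))"

text \<open>Every set \<open>S\<close> of unordered pairs encodes a tournament: membership of \<open>{a, b}\<close> says that
  the edge points from the smaller to the larger vertex.\<close>

definition tournament_of :: "nat set set \<Rightarrow> nat \<Rightarrow> nat \<Rightarrow> bool" where
  "tournament_of S a b \<longleftrightarrow> a = b \<or> ((a < b) = ({a, b} \<in> S))"

lemma tournament_of_antisym: "a \<noteq> b \<Longrightarrow> tournament_of S b a \<longleftrightarrow> \<not> tournament_of S a b"
  unfolding tournament_of_def insert_commute[of b a] by auto

text \<open>The zero pattern decides whether each pair {\<rho> i, \<sigma> j} with j < i lies in
  \<open>S\<close>, and these r (r - 1) / 2 pairs are distinct once \<open>E\<close> is nonempty. So
  a member of \<open>E\<close> is determined by its part outside them. Counting families of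
  arbitrary subsets, not just of pairs, puts the same extra factor on both sides.\<close>

lemma card_tournaments_with_triangle:
  fixes \<rho> \<sigma> :: "nat \<Rightarrow> nat"
  assumes \<rho>: "inj_on \<rho> {..<r}" "\<rho> ` {..<r} \<subseteq> {..<h}"
    and \<sigma>: "inj_on \<sigma> {..<r}" "\<sigma> ` {..<r} \<subseteq> {..<h}"
  defines "E \<equiv> {S \<in> Pow (Pow {..<h}). \<forall>i<r. \<forall>j<i. \<not> tournament_of S (\<rho> i) (\<sigma> j)}"
  shows "card E * 2 ^ (r * (r - 1) div 2) \<le> 2 ^ card (Pow {..<h})"
proof (cases "E = {}")
  case False
  then obtain S0 where S0: "S0 \<in> E" by blast
  define D where "D = (SIGMA i:{..<r}. {..<i})"
  define q where "q = (\<lambda>(i, j). {\<rho> i, \<sigma> j})"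
  define Q where "Q = q ` D"
  have zero: "\<not> tournament_of S (\<rho> i) (\<sigma> j)" if "S \<in> E" "(i, j) \<in> D" for S i j
    using that by (auto simp: E_def D_def)
  have inj: "inj_on q D"
  proof (rule inj_onI, clarify)
    fix i j i' j' assume D: "(i, j) \<in> D" "(i', j') \<in> D" and "q (i, j) = q (i', j')"
    then consider "\<rho> i = \<rho> i'" "\<sigma> j = \<sigma> j'" | "\<rho> i = \<sigma> j'" "\<sigma> j = \<rho> i'"
      by (auto simp: q_def doubleton_eq_iff)
    then show "i = i' \<and> j = j'"
    proof cases
      case 1
      then show ?thesis
        using D inj_onD[OF \<rho>(1), of i i'] inj_onD[OF \<sigma>(1), of j j'] by (auto simp: D_def)
    next
      \<comment> \<open>The entries (a, b) and (b, a) would both be zero in the tournament of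
        \<open>S0\<close>, against antisymmetry, or against the ones on the diagonal if a =
        b.\<close>
      case 2
      then show ?thesis
        using zero[OF S0 D(1)] zero[OF S0 D(2)] tournament_of_antisym[of "\<rho> i" "\<sigma> j" S0]
        by (auto simp: tournament_of_def)
    qed
  qed
  have "card D = (\<Sum>i<r. i)"
    by (simp add: D_def)
  also have "\<dots> = r * (r - 1) div 2"
    using Sum_Ico_nat[of 0 r] by (simp add: atLeast0LessThan)
  finally have cardQ: "card Q = r * (r - 1) div 2"
    unfolding Q_def using card_image[OF inj] by simp
  have Q_sub: "Q \<subseteq> Pow {..<h}"
  proof
    fix x assume "x \<in> Q"
    then obtain i j where "i < r" "j < i" "x = {\<rho> i, \<sigma> j}"
      by (auto simp: Q_def D_def q_def)
    moreover from this have "i \<in> {..<r}" "j \<in> {..<r}" by auto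
    ultimately show "x \<in> Pow {..<h}" using \<rho>(2) \<sigma>(2) by blast
  qed
  \<comment> \<open>A zero entry at (a, b) forces a \<noteq> b, so {a, b} is in the set exactly when
    b < a, whichever member of \<open>E\<close> is taken.\<close>
  have agree: "x \<in> S \<longleftrightarrow> x \<in> S'" if "S \<in> E" "S' \<in> E" "x \<in> Q" for S S' x
  proof -
    obtain i j where "(i, j) \<in> D" "x = {\<rho> i, \<sigma> j}"
      using \<open>x \<in> Q\<close> by (auto simp: Q_def q_def)
    then show ?thesis
      using zero[of S i j] zero[of S' i j] that by (auto simp: tournament_of_def)
  qed
  have "inj_on (\<lambda>S. S - Q) E"
  proof (rule inj_onI)
    fix S S' assume "S \<in> E" "S' \<in> E" "S - Q = S' - Q"
    then show "S = S'" using agree[of S S'] by blast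
  qed
  moreover have "(\<lambda>S. S - Q) ` E \<subseteq> Pow (Pow {..<h} - Q)"
    by (auto simp: E_def)
  ultimately have "card E \<le> card (Pow (Pow {..<h} - Q))"
    by (intro card_inj_on_le) auto
  also have "\<dots> = 2 ^ (card (Pow {..<h}) - card Q)"
    using Q_sub by (simp add: card_Pow card_Diff_subset finite_subset[OF Q_sub])
  finally have "card E * 2 ^ card Q \<le> 2 ^ (card (Pow {..<h}) - card Q) * 2 ^ card Q"
    by simp
  also have "\<dots> = 2 ^ card (Pow {..<h})"
    using card_mono[OF _ Q_sub] by (simp flip: power_add)
  finally show ?thesis
    by (simp add: cardQ)
qed simp

text \<open>Union bound: there are at most \<open>h ^ (2 * r)\<close> placements (\<rho>, \<sigma>),
  and each is bad for at most a fraction 2^-m of all families \<open>S\<close>, so some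
  \<open>S\<close> is bad for none.\<close>

lemma ex_triangle_free_tournament:
  assumes "h ^ (2 * r) < 2 ^ (r * (r - 1) div 2)"
  shows "\<exists>B. (\<forall>a. B a a) \<and> (\<forall>a b. a \<noteq> b \<longrightarrow> \<not> (B a b \<and> B b a)) \<and> triangle_free h B r"
proof -
  \<comment> \<open>Extensional functions keep the set of placements finite; arbitrary \<rho> and
    \<sigma> are restricted to {..<r} at the end.\<close>
  define F where "F = {..<r} \<rightarrow>\<^sub>E {..<h}"
  define G where "G = {(\<rho>, \<sigma>) \<in> F \<times> F. inj_on \<rho> {..<r} \<and> inj_on \<sigma> {..<r}}"
  define E where "E = (\<lambda>(\<rho>, \<sigma>). {S \<in> Pow (Pow {..<h}).
    \<forall>i<r. \<forall>j<i. \<not> tournament_of S (\<rho> i) (\<sigma> j)})"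
  define m where "m = r * (r - 1) div 2"
  have fin: "finite F"
    by (auto simp: F_def intro: finite_PiE)
  have G_sub: "G \<subseteq> F \<times> F"
    by (auto simp: G_def)
  then have "finite G"
    using fin finite_subset by blast
  have "card G \<le> card (F \<times> F)"
    using card_mono[OF _ G_sub] fin by simp
  also have "\<dots> = h ^ (2 * r)"
    by (simp add: F_def card_PiE card_cartesian_product mult_2 power_add)
  finally have cardG: "card G < 2 ^ m"
    using assms by (simp add: m_def)
  have E_le: "card (E g) * 2 ^ m \<le> 2 ^ card (Pow {..<h})" if g: "g \<in> G" for g
  proof -
    obtain \<rho> \<sigma> where "g = (\<rho>, \<sigma>)" by force
    with g show ?thesis
      using card_tournaments_with_triangle[of \<rho> r h \<sigma>]
      by (auto simp: G_def F_def E_def m_def PiE_def Pi_def image_subset_iff)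
  qed
  have "card (\<Union>g\<in>G. E g) * 2 ^ m \<le> (\<Sum>g\<in>G. card (E g)) * 2 ^ m"
    using card_UN_le[OF \<open>finite G\<close>] by (intro mult_right_mono) auto
  also have "\<dots> \<le> (\<Sum>g\<in>G. 2 ^ card (Pow {..<h}))"
    unfolding sum_distrib_right by (intro sum_mono E_le)
  also have "\<dots> = card G * 2 ^ card (Pow {..<h})"
    by simp
  also have "\<dots> < 2 ^ m * 2 ^ card (Pow {..<h})"
    using cardG by simp
  finally have "card (\<Union>g\<in>G. E g) < 2 ^ card (Pow {..<h})"
    by (simp add: mult.commute)
  then have "(\<Union>g\<in>G. E g) \<noteq> Pow (Pow {..<h})"
    by (metis card_Pow finite_Pow_iff finite_lessThan less_irrefl)
  moreover have "(\<Union>g\<in>G. E g) \<subseteq> Pow (Pow {..<h})"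
    by (auto simp: E_def)
  ultimately obtain S where S: "S \<in> Pow (Pow {..<h})" "\<And>g. g \<in> G \<Longrightarrow> S \<notin> E g"
    by blast
  have "triangle_free h (tournament_of S) r"
    unfolding triangle_free_def
  proof (intro allI impI)
    fix \<rho> \<sigma> :: "nat \<Rightarrow> nat"
    assume "inj_on \<rho> {..<r}" "\<rho> ` {..<r} \<subseteq> {..<h}" "inj_on \<sigma> {..<r}" "\<sigma> ` {..<r} \<subseteq> {..<h}"
    then have "(restrict \<rho> {..<r}, restrict \<sigma> {..<r}) \<in> G"
      by (auto simp: G_def F_def image_subset_iff)
    from S(2)[OF this] S(1) obtain i j where "i < r" "j < i"
      "tournament_of S (restrict \<rho> {..<r} i) (restrict \<sigma> {..<r} j)"
      unfolding E_def by blast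
    then show "\<exists>i<r. \<exists>j<i. tournament_of S (\<rho> i) (\<sigma> j)" by auto
  qed
  moreover have "\<forall>a. tournament_of S a a"
    by (simp add: tournament_of_def)
  ultimately show ?thesis
    using tournament_of_antisym[of _ _ S] by blast
qed

section \<open>The symmetric matrix of a tournament\<close>

definition bipartite_mat :: "nat \<Rightarrow> (nat \<Rightarrow> nat \<Rightarrow> bool) \<Rightarrow> int mat" where
  "bipartite_mat h B = mat (2 * h) (2 * h) (\<lambda>(i, j).
     of_bool (i < h \<and> h \<le> j \<and> B i (j - h) \<or> h \<le> i \<and> j < h \<and> B j (i - h)))"

lemma bipartite_mat_carrier: "bipartite_mat h B \<in> carrier_mat (2 * h) (2 * h)"
  by (simp add: bipartite_mat_def)

lemma bipartite_mat_index:
  "i < 2 * h \<Longrightarrow> j < 2 * h \<Longrightarrow> bipartite_mat h B $$ (i, j) =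
     of_bool (i < h \<and> h \<le> j \<and> B i (j - h) \<or> h \<le> i \<and> j < h \<and> B j (i - h))"
  by (simp add: bipartite_mat_def)

lemma zero_one_bipartite_mat: "zero_one_mat (bipartite_mat h B)"
  by (auto simp: zero_one_mat_def elements_mat_def bipartite_mat_def)

lemma symmetric_bipartite_mat: "symmetric_mat (bipartite_mat h B)"
  unfolding symmetric_mat_def by (rule eq_matI) (auto simp: bipartite_mat_def)

subsection \<open>Triangular submatrices\<close>

text \<open>Listing \<open>I\<close> in increasing order preserves the zero pattern, so the r
  smallest elements would already give a forbidden placement.\<close>

lemma triangle_free_card_less:
  fixes \<rho> \<sigma> :: "nat \<Rightarrow> nat"
  assumes free: "triangle_free h B r" and "finite I"
    and \<rho>: "inj_on \<rho> I" "\<rho> ` I \<subseteq> {..<h}" and \<sigma>: "inj_on \<sigma> I" "\<sigma> ` I \<subseteq> {..<h}"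
    and zero: "\<And>i j. i \<in> I \<Longrightarrow> j \<in> I \<Longrightarrow> j < i \<Longrightarrow> \<not> B (\<rho> i) (\<sigma> j)"
  shows "card I < r"
proof (rule ccontr)
  assume "\<not> card I < r"
  then have r: "{..<r} \<subseteq> {..<card I}" by auto
  obtain e where e: "bij_betw e {..<card I} I" "strict_mono_on {..<card I} e"
    using ex_bij_betw_strict_mono_card[OF \<open>finite I\<close>] by blast
  have e_in: "e ` {..<r} \<subseteq> I"
    using e(1) r by (auto simp: bij_betw_def)
  have e_inj: "inj_on e {..<r}"
    using e(1) r by (auto simp: bij_betw_def intro: inj_on_subset)
  have "\<exists>i<r. \<exists>j<i. B ((\<rho> \<circ> e) i) ((\<sigma> \<circ> e) j)"
  proof (rule free[unfolded triangle_free_def, rule_format])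
    show "inj_on (\<rho> \<circ> e) {..<r}" "inj_on (\<sigma> \<circ> e) {..<r}"
      by (intro comp_inj_on e_inj inj_on_subset[OF \<rho>(1) e_in] inj_on_subset[OF \<sigma>(1) e_in])+
    show "(\<rho> \<circ> e) ` {..<r} \<subseteq> {..<h}" "(\<sigma> \<circ> e) ` {..<r} \<subseteq> {..<h}"
      unfolding image_comp[symmetric] using \<rho>(2) \<sigma>(2) e_in by blast+
  qed
  then obtain i j where ij: "i < r" "j < i" "B (\<rho> (e i)) (\<sigma> (e j))" by auto
  then have "e j < e i"
    using r by (intro strict_mono_onD[OF e(2)]) auto
  then show False
    using zero[of "e i" "e j"] ij e_in by (simp add: image_subset_iff)
qed

lemma triangle_free_card_less':
  fixes \<rho> \<sigma> :: "nat \<Rightarrow> nat"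
  assumes free: "triangle_free h B r"
    and I: "I \<subseteq> {..<n}"
    and \<rho>: "inj_on \<rho> I" "\<rho> ` I \<subseteq> {..<h}" and \<sigma>: "inj_on \<sigma> I" "\<sigma> ` I \<subseteq> {..<h}"
    and zero: "\<And>i j. i \<in> I \<Longrightarrow> j \<in> I \<Longrightarrow> i < j \<Longrightarrow> \<not> B (\<rho> i) (\<sigma> j)"
  shows "card I < r"
proof -
  \<comment> \<open>An order-reversing involution on {..<n}; it moves the zeros from above the
    diagonal to below it.\<close>
  define f where "f = (\<lambda>i. n - Suc i)"
  have ff: "f (f i) = i" if "i \<in> I" for i
    using that I by (auto simp: f_def)
  have f_inj: "inj_on f I"
    by (metis ff inj_onI)
  have "finite I" using I finite_subset by blast
  have inj: "inj_on (\<rho> \<circ> f) (f ` I)" "inj_on (\<sigma> \<circ> f) (f ` I)"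
    using \<rho>(1) \<sigma>(1) ff by (auto simp: inj_on_def)
  have "card (f ` I) < r"
  proof (rule triangle_free_card_less[OF free _ inj(1) _ inj(2)])
    show "\<not> B ((\<rho> \<circ> f) i) ((\<sigma> \<circ> f) j)" if "i \<in> f ` I" "j \<in> f ` I" "j < i" for i j
    proof -
      obtain k l where kl: "k \<in> I" "l \<in> I" "i = f k" "j = f l" using \<open>i \<in> _\<close> \<open>j \<in> _\<close> by blast
      then have "k < l" using \<open>j < i\<close> by (auto simp: f_def)
      then show ?thesis using zero[of k l] kl ff by auto
    qed
  qed (use \<open>finite I\<close> \<rho>(2) \<sigma>(2) ff in auto)
  then show ?thesis using card_image[OF f_inj] by simp
qed

text \<open>The diagonal blocks of the matrix vanish, so a one at (\<rho> i, \<sigma> i) puts row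
  and column in opposite halves. The indices thus split into a triangle in \<open>B\<close> and one
  in its transpose, each with at most r - 1 indices.\<close>

lemma triangle_bipartite_mat_le:
  assumes free: "triangle_free h B r"
    and \<rho>: "inj_on \<rho> {..<n}" "\<rho> ` {..<n} \<subseteq> {..<2 * h}"
    and \<sigma>: "inj_on \<sigma> {..<n}" "\<sigma> ` {..<n} \<subseteq> {..<2 * h}"
    and diag: "\<And>i. i < n \<Longrightarrow> bipartite_mat h B $$ (\<rho> i, \<sigma> i) = 1"
    and zero: "\<And>i j. i < n \<Longrightarrow> j < i \<Longrightarrow> bipartite_mat h B $$ (\<rho> i, \<sigma> j) = 0"
  shows "n \<le> 2 * (r - 1)"
proof -
  define I where "I = {i. i < n \<and> \<rho> i < h}"
  define J where "J = {i. i < n \<and> \<not> \<rho> i < h}"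
  have lt: "\<rho> i < 2 * h" "\<sigma> i < 2 * h" if "i < n" for i
    using \<rho>(2) \<sigma>(2) that by auto
  have \<sigma>I: "h \<le> \<sigma> i" if "i \<in> I" for i
    using diag[of i] that lt[of i] by (auto simp: I_def bipartite_mat_index split: if_splits)
  have \<sigma>J: "\<sigma> i < h" if "i \<in> J" for i
    using diag[of i] that lt[of i] by (auto simp: J_def bipartite_mat_index split: if_splits)
  have inj: "i = j" if "\<rho> i = \<rho> j \<or> \<sigma> i = \<sigma> j" "i < n" "j < n" for i j
    using that inj_onD[OF \<rho>(1), of i j] inj_onD[OF \<sigma>(1), of i j] by auto
  have "card I < r"
  proof (rule triangle_free_card_less[OF free, of _ \<rho> "\<lambda>i. \<sigma> i - h"])
    show "inj_on (\<lambda>i. \<sigma> i - h) I"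
    proof (rule inj_onI)
      fix i j assume "i \<in> I" "j \<in> I" "\<sigma> i - h = \<sigma> j - h"
      then have "\<sigma> i = \<sigma> j" using \<sigma>I[of i] \<sigma>I[of j] by linarith
      then show "i = j" using inj[of i j] \<open>i \<in> I\<close> \<open>j \<in> I\<close> by (simp add: I_def)
    qed
    show "(\<lambda>i. \<sigma> i - h) ` I \<subseteq> {..<h}"
    proof clarify
      fix i assume "i \<in> I"
      then show "\<sigma> i - h < h" using \<sigma>I[of i] lt(2)[of i] by (simp add: I_def)
    qed
    show "\<not> B (\<rho> i) (\<sigma> j - h)" if "i \<in> I" "j \<in> I" "j < i" for i j
      using zero[of i j] that \<sigma>I[of j] lt[of i] lt[of j] by (auto simp: I_def bipartite_mat_index)
    show "inj_on \<rho> I" by (rule inj_on_subset[OF \<rho>(1)]) (auto simp: I_def)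
  qed (auto simp: I_def)
  moreover have "card J < r"
  proof (rule triangle_free_card_less'[OF free, of J n \<sigma> "\<lambda>i. \<rho> i - h"])
    show "inj_on (\<lambda>i. \<rho> i - h) J"
    proof (rule inj_onI)
      fix i j assume "i \<in> J" "j \<in> J" "\<rho> i - h = \<rho> j - h"
      then have "\<rho> i = \<rho> j" by (auto simp: J_def)
      then show "i = j" using inj[of i j] \<open>i \<in> J\<close> \<open>j \<in> J\<close> by (simp add: J_def)
    qed
    show "(\<lambda>i. \<rho> i - h) ` J \<subseteq> {..<h}"
    proof clarify
      fix i assume "i \<in> J"
      then show "\<rho> i - h < h" using lt(1)[of i] by (simp add: J_def)
    qed
    \<comment> \<open>In the lower left block rows and columns of \<open>B\<close> swap roles, so
      zeros below the diagonal become zeros above it.\<close>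
    show "\<not> B (\<sigma> i) (\<rho> j - h)" if "i \<in> J" "j \<in> J" "i < j" for i j
      using zero[of j i] that \<sigma>J[of i] lt[of i] lt[of j] by (auto simp: J_def bipartite_mat_index)
    show "inj_on \<sigma> J" by (rule inj_on_subset[OF \<sigma>(1)]) (auto simp: J_def)
    show "\<sigma> ` J \<subseteq> {..<h}" using \<sigma>J by blast
  qed (auto simp: J_def)
  moreover have "card (I \<union> J) = card I + card J"
    by (intro card_Un_disjoint) (auto simp: I_def J_def)
  moreover have "I \<union> J = {..<n}"
    by (auto simp: I_def J_def)
  ultimately show ?thesis by simp
qed

lemma him_bipartite_mat_le:
  assumes free: "triangle_free h B r"
  shows "him (bipartite_mat h B) \<le> 2 * (r - 1)"
proof -
  let ?A = "bipartite_mat h B"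
  have sym: "?A $$ (i, j) = ?A $$ (j, i)" if "i < 2 * h" "j < 2 * h" for i j
    using that by (auto simp: bipartite_mat_index)
  obtain T where T: "T \<in> carrier_mat (him ?A) (him ?A)" "triangular_mat T" "ones_on_diagonal T"
      "submatrix_up_to_perm T ?A"
    using Max_in[OF him_admissible[of ?A]] unfolding him_def by blast
  define n where "n = him ?A"
  have dims: "dim_row T = n" "dim_col T = n" "dim_row ?A = 2 * h" "dim_col ?A = 2 * h"
    using T(1) bipartite_mat_carrier[of h B] by (auto simp: n_def)
  from T(4) obtain \<rho> \<sigma> where \<rho>: "inj_on \<rho> {..<n}" "\<rho> ` {..<n} \<subseteq> {..<2 * h}"
    and \<sigma>: "inj_on \<sigma> {..<n}" "\<sigma> ` {..<n} \<subseteq> {..<2 * h}"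
    and T_eq: "T = mat n n (\<lambda>(i, j). ?A $$ (\<rho> i, \<sigma> j))"
    unfolding submatrix_up_to_perm_def dims by blast
  have entry: "T $$ (i, j) = ?A $$ (\<rho> i, \<sigma> j)" if "i < n" "j < n" for i j
    unfolding T_eq using that by simp
  have entry': "T $$ (i, j) = ?A $$ (\<sigma> j, \<rho> i)" if "i < n" "j < n" for i j
    using entry[OF that] sym[of "\<rho> i" "\<sigma> j"] that \<rho>(2) \<sigma>(2) by (auto simp: image_subset_iff)
  have diag: "T $$ (i, i) = 1" if "i < n" for i
    using T(3) that by (simp add: ones_on_diagonal_def dims)
  from T(2) consider "upper_triangular T" | "upper_triangular (transpose_mat T)"
    by (auto simp: triangular_mat_def)
  then have "n \<le> 2 * (r - 1)"
  proof cases
    case 1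
    then have "T $$ (i, j) = 0" if "i < n" "j < i" for i j
      using that by (auto simp: dims)
    then show ?thesis
      by (intro triangle_bipartite_mat_le[OF free \<rho> \<sigma>]) (use diag entry in force)+
  next
    case 2
    then have "transpose_mat T $$ (i, j) = 0" if "i < n" "j < i" for i j
      using that by (auto simp: dims simp del: index_transpose_mat(1))
    then have "T $$ (j, i) = 0" if "i < n" "j < i" for i j
      using that by (force simp: dims)
    \<comment> \<open>A lower triangular submatrix becomes upper triangular on exchanging \<rho> and
      \<sigma>, because the big matrix is symmetric.\<close>
    then show ?thesis
      by (intro triangle_bipartite_mat_le[OF free \<sigma> \<rho>]) (use diag entry' in force)+
  qed
  then show ?thesis by (simp add: n_def)
qed

subsection \<open>Identity submatrices of the Kronecker powers\<close>

lemma dim_kronecker_prod [simp]: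
  "dim_row (kronecker_prod A B) = dim_row A * dim_row B"
  "dim_col (kronecker_prod A B) = dim_col A * dim_col B"
  by (simp_all add: kronecker_prod_def)

lemma mult_add_less: "a * n + b < m * n" if "a < m" "b < n" for a b m n :: nat
proof -
  have "a * n + b < Suc a * n" using that by simp
  also have "\<dots> \<le> m * n" using that by (intro mult_right_mono) auto
  finally show ?thesis .
qed

lemma kronecker_prod_index:
  assumes "a < dim_row A" "b < dim_row B" "c < dim_col A" "d < dim_col B"
  shows "kronecker_prod A B $$ (a * dim_row B + b, c * dim_col B + d) = A $$ (a, c) * B $$ (b, d)"
  using assms by (simp add: kronecker_prod_def mult_add_less)

text \<open>Injectivity comes for free: the rows of an identity matrix are pairwise distinct, and so
  are its columns.\<close>

lemma one_submatrix_iff: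
  fixes M :: "int mat"
  shows "submatrix_up_to_perm (1\<^sub>m n) M \<longleftrightarrow>
    (\<exists>\<rho> \<sigma>. (\<forall>i<n. \<rho> i < dim_row M \<and> \<sigma> i < dim_col M) \<and>
           (\<forall>i<n. \<forall>j<n. M $$ (\<rho> i, \<sigma> j) = of_bool (i = j)))" (is "?L \<longleftrightarrow> (\<exists>\<rho> \<sigma>. ?R \<rho> \<sigma>)")
proof
  assume ?L
  then obtain \<rho> \<sigma> where *: "\<rho> ` {..<n} \<subseteq> {..<dim_row M}" "\<sigma> ` {..<n} \<subseteq> {..<dim_col M}"
    and eq: "1\<^sub>m n = mat n n (\<lambda>(i, j). M $$ (\<rho> i, \<sigma> j))"
    unfolding submatrix_up_to_perm_def by auto
  have "M $$ (\<rho> i, \<sigma> j) = of_bool (i = j)" if "i < n" "j < n" for i j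
    using arg_cong[OF eq, of "\<lambda>N. N $$ (i, j)"] that by (auto split: if_splits)
  with * show "\<exists>\<rho> \<sigma>. ?R \<rho> \<sigma>" by blast
next
  assume "\<exists>\<rho> \<sigma>. ?R \<rho> \<sigma>"
  then obtain \<rho> \<sigma> where R: "?R \<rho> \<sigma>" by blast
  have "inj_on \<rho> {..<n}"
  proof (rule inj_onI)
    fix i j assume "i \<in> {..<n}" "j \<in> {..<n}" "\<rho> i = \<rho> j"
    then have "(of_bool (i = j) :: int) = of_bool (j = j)" using R by (metis lessThan_iff)
    then show "i = j" by simp
  qed
  moreover have "inj_on \<sigma> {..<n}"
  proof (rule inj_onI)
    fix i j assume "i \<in> {..<n}" "j \<in> {..<n}" "\<sigma> i = \<sigma> j"
    then have "(of_bool (i = j) :: int) = of_bool (i = i)" using R by (metis lessThan_iff)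
    then show "i = j" by simp
  qed
  moreover have "1\<^sub>m n = mat n n (\<lambda>(i, j). M $$ (\<rho> i, \<sigma> j))"
    using R by (intro eq_matI) auto
  ultimately show ?L
    using R unfolding submatrix_up_to_perm_def by (intro exI[of _ \<rho>] exI[of _ \<sigma>]) auto
qed

text \<open>Rows (u a, u' a) and columns (v b, v' b) cut out of M \<otimes> M the Hadamard product
  of two submatrices of \<open>M\<close>. If that is the identity of size m, tensoring with the one
  in \<open>N\<close> gives the identity of size m n.\<close>

lemma one_submatrix_kronecker_prod:
  fixes M N :: "int mat"
  assumes "submatrix_up_to_perm (1\<^sub>m n) N"
    and less: "\<And>a. a < m \<Longrightarrow> u a < dim_row M \<and> u' a < dim_row M \<and> v a < dim_col M \<and> v' a < dim_col M"
    and prod: "\<And>a b. a < m \<Longrightarrow> b < m \<Longrightarrow>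
      M $$ (u a, v b) * M $$ (u' a, v' b) = of_bool (a = b)"
  shows "submatrix_up_to_perm (1\<^sub>m (m * n)) (kronecker_prod M (kronecker_prod M N))"
proof -
  let ?K = "kronecker_prod M N"
  obtain \<rho> \<sigma> where \<rho>\<sigma>: "\<And>i. i < n \<Longrightarrow> \<rho> i < dim_row N" "\<And>i. i < n \<Longrightarrow> \<sigma> i < dim_col N"
    and id: "\<And>i j. i < n \<Longrightarrow> j < n \<Longrightarrow> N $$ (\<rho> i, \<sigma> j) = of_bool (i = j)"
    using assms(1) unfolding one_submatrix_iff by blast
  \<comment> \<open>The index t < m n encodes the pair (\<open>t div n\<close>,
    \<open>t mod n\<close>): the first component selects in the two copies of \<open>M\<close>, the
    second in \<open>N\<close>.\<close>
  define \<rho>' where "\<rho>' = (\<lambda>t. u (t div n) * dim_row ?K + (u' (t div n) * dim_row N + \<rho> (t mod n)))"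
  define \<sigma>' where "\<sigma>' = (\<lambda>t. v (t div n) * dim_col ?K + (v' (t div n) * dim_col N + \<sigma> (t mod n)))"
  have t: "t div n < m" "t mod n < n" if "t < m * n" for t
    using that by (auto simp: less_mult_imp_div_less) (metis mod_less_divisor mult_0_right not_less0 neq0_conv)
  have row: "u' (t div n) * dim_row N + \<rho> (t mod n) < dim_row ?K"
    and col: "v' (t div n) * dim_col N + \<sigma> (t mod n) < dim_col ?K" if "t < m * n" for t
    using less[OF t(1)[OF that]] \<rho>\<sigma>[OF t(2)[OF that]] by (auto intro: mult_add_less)
  have bound: "\<rho>' t < dim_row (kronecker_prod M ?K)" "\<sigma>' t < dim_col (kronecker_prod M ?K)"
    if "t < m * n" for t
    using less[OF t(1)[OF that]] row[OF that] col[OF that]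
    unfolding \<rho>'_def \<sigma>'_def dim_kronecker_prod(1)[of M ?K] dim_kronecker_prod(2)[of M ?K]
    by (blast intro: mult_add_less)+
  have "kronecker_prod M ?K $$ (\<rho>' s, \<sigma>' t) = of_bool (s = t)" if s: "s < m * n" and t': "t < m * n" for s t
  proof -
    have "kronecker_prod M ?K $$ (\<rho>' s, \<sigma>' t) = M $$ (u (s div n), v (t div n)) *
       (M $$ (u' (s div n), v' (t div n)) * N $$ (\<rho> (s mod n), \<sigma> (t mod n)))"
      unfolding \<rho>'_def \<sigma>'_def
      using less[OF t(1)[OF s]] less[OF t(1)[OF t']] \<rho>\<sigma>(1)[OF t(2)[OF s]] \<rho>\<sigma>(2)[OF t(2)[OF t']]
        row[OF s] col[OF t']
      by (simp only: kronecker_prod_index)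
    also have "\<dots> = of_bool (s div n = t div n) * of_bool (s mod n = t mod n)"
      unfolding mult.assoc[symmetric] using s t' t by (simp only: prod id)
    also have "\<dots> = of_bool (s = t)"
      by (auto; metis div_mult_mod_eq)
    finally show ?thesis .
  qed
  with bound show ?thesis
    unfolding one_submatrix_iff by blast
qed

text \<open>Each two further factors multiply the size by h: the first is read in the block
  \<open>B\<close>, the second in its transpose, and \<open>B a b\<close> and \<open>B b a\<close>
  hold together only for a = b.\<close>

lemma one_submatrix_kronecker_power_bipartite_mat:
  assumes refl: "\<And>a. B a a" and antisym: "\<And>a b. a \<noteq> b \<Longrightarrow> \<not> (B a b \<and> B b a)"
  shows "submatrix_up_to_perm (1\<^sub>m (h ^ k)) (kronecker_power (bipartite_mat h B) (2 * k))"
proof (induction k)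
  case 0
  show ?case
    unfolding one_submatrix_iff by (intro exI[of _ "\<lambda>_. 0"]) auto
next
  case (Suc k)
  have "submatrix_up_to_perm (1\<^sub>m (h * h ^ k)) (kronecker_prod (bipartite_mat h B)
      (kronecker_prod (bipartite_mat h B) (kronecker_power (bipartite_mat h B) (2 * k))))"
  proof (rule one_submatrix_kronecker_prod[OF Suc, where u = "\<lambda>a. a" and v = "\<lambda>a. a + h"
        and u' = "\<lambda>a. a + h" and v' = "\<lambda>a. a"])
    show "bipartite_mat h B $$ (a, b + h) * bipartite_mat h B $$ (a + h, b) = of_bool (a = b)"
      if "a < h" "b < h" for a b
      using that refl antisym[of a b] by (auto simp: bipartite_mat_index)
  qed (use bipartite_mat_carrier[of h B] in auto)
  then show ?case by simp
qed

lemma mimsup_bipartite_mat_ge: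
  assumes "\<And>a. B a a" and "\<And>a b. a \<noteq> b \<Longrightarrow> \<not> (B a b \<and> B b a)"
  shows "ereal (sqrt (real h)) \<le> mimsup (bipartite_mat h B)"
proof -
  define X where "X = (\<lambda>k. ereal (root k (real (mim (kronecker_power (bipartite_mat h B) k)))))"
  \<comment> \<open>The case k = 0 is left out because \<open>root 0\<close> is 0 by
    convention.\<close>
  have "ereal (sqrt (real h)) \<le> X (2 * k)" if "k > 0" for k
  proof -
    have "h ^ k \<le> mim (kronecker_power (bipartite_mat h B) (2 * k))"
      unfolding mim_def
      using one_submatrix_kronecker_power_bipartite_mat[OF assms] mim_admissible(1)
      by (intro Max_ge) auto
    then have "real h ^ k \<le> real (mim (kronecker_power (bipartite_mat h B) (2 * k)))"
      by (metis of_nat_le_iff of_nat_power)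
    then have "root (2 * k) (real h ^ k) \<le> root (2 * k) (real (mim (kronecker_power (bipartite_mat h B) (2 * k))))"
      using that by simp
    moreover have "root (2 * k) (real h ^ k) = sqrt (real h)"
      using that by (simp add: real_root_mult_exp sqrt_def real_root_power_cancel real_root_power)
    ultimately show ?thesis by (simp add: X_def)
  qed
  then have "\<forall>\<^sub>F k in sequentially. ereal (sqrt (real h)) \<le> (X \<circ> (*) 2) k"
    by (intro eventually_sequentiallyI[of 1]) auto
  then have "ereal (sqrt (real h)) \<le> limsup (X \<circ> (*) 2)"
    by (intro le_Limsup) auto
  \<comment> \<open>Even exponents form a subsequence, whose limsup bounds the full one from
    below.\<close>
  also have "\<dots> \<le> limsup X"
    by (intro limsup_subseq_mono strict_monoI) simp
  finally show ?thesis
    by (simp add: mimsup_def X_def)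
qed

section \<open>Choice of the parameters\<close>

theorem theorem40:
  shows "\<exists>C::real. C > 1 \<and>
    (\<forall>\<^sub>F h::nat in sequentially.
       \<exists>A \<in> carrier_mat (2 * h) (2 * h).
         zero_one_mat A \<and> symmetric_mat A \<and>
         real (him A) \<le> 10 * log 2 (real h) \<and>
         mimsup A \<ge> ereal (sqrt (real h)))"
proof (intro exI conjI eventually_sequentiallyI)
  show "(2::real) > 1" by simp
next
  \<comment> \<open>From h \<ge> 2 follows L \<ge> 1, so rounding 5 L down still leaves more than 4
    L.\<close>
  fix h :: nat assume h: "2 \<le> h"
  define L where "L = log 2 (real h)"
  \<comment> \<open>With r = m + 1 the bound 2 (r - 1) on \<open>him\<close> is 2 m \<le> 10 L,
    while the union bound needs 2 r L < r (r - 1) / 2, that is, 4 L < m.\<close>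
  define m where "m = nat \<lfloor>5 * L\<rfloor>"
  have "L \<ge> 1" using h by (simp add: L_def)
  then have m_le: "real m \<le> 5 * L" and m_gt: "4 * L < real m"
    unfolding m_def by linarith+
  \<comment> \<open>Evenness makes the truncating \<open>div 2\<close> an exact division over the
    reals.\<close>
  have "even (Suc m * m)" by simp
  have "real (2 * Suc m) * L < real (Suc m * m div 2)"
  proof -
    have "real (2 * Suc m) * L = real (Suc m) * (4 * L) / 2" by simp
    also have "\<dots> < real (Suc m) * real m / 2"
      using m_gt by (intro divide_strict_right_mono mult_strict_left_mono) auto
    also have "\<dots> = real (Suc m * m div 2)"
      using \<open>even (Suc m * m)\<close> by (metis of_nat_mult of_nat_numeral real_of_nat_div)
    finally show ?thesis .
  qed
  then have "2 powr (L * real (2 * Suc m)) < 2 powr real (Suc m * m div 2)"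
    by (simp only: mult.commute powr_less_cancel_iff one_less_numeral_iff semiring_norm)
  moreover have "2 powr (L * real (2 * Suc m)) = real h ^ (2 * Suc m)"
    using h by (simp only: powr_powr[symmetric] powr_realpow[symmetric] L_def) (simp add: powr_realpow)
  moreover have "2 powr real (Suc m * m div 2) = (2::real) ^ (Suc m * m div 2)"
    by (simp only: powr_realpow zero_less_numeral)
  ultimately have "real (h ^ (2 * Suc m)) < real (2 ^ (Suc m * m div 2))"
    by (simp only: of_nat_power of_nat_numeral)
  then have "h ^ (2 * Suc m) < 2 ^ (Suc m * (Suc m - 1) div 2)"
    unfolding of_nat_less_iff by simp
  from ex_triangle_free_tournament[OF this]
  obtain B where B: "\<And>a. B a a" "\<And>a b. a \<noteq> b \<Longrightarrow> \<not> (B a b \<and> B b a)" "triangle_free h B (Suc m)"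
    by blast
  have "real (him (bipartite_mat h B)) \<le> 10 * L"
    using him_bipartite_mat_le[OF B(3)] m_le by simp
  then show "\<exists>A \<in> carrier_mat (2 * h) (2 * h). zero_one_mat A \<and> symmetric_mat A \<and>
         real (him A) \<le> 10 * log 2 (real h) \<and> mimsup A \<ge> ereal (sqrt (real h))"
    using bipartite_mat_carrier zero_one_bipartite_mat symmetric_bipartite_mat
      mimsup_bipartite_mat_ge[of B h, OF B(1,2)] unfolding L_def by blast
qed

end
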